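(* Let $a>0$ and let $(g_n)_{n\in\mathbb N}$ be an $a$-orthonormal sequence in $L^2(\mathbb R)$. Then for all $f\in L^2(\mathbb R)$: (1) the series of functions $\sum_{n\in\mathbb N}\langle f,g_n\rangle_a\, g_n$ converges in $L^2(\mathbb R)$; (2) (Bessel's inequality) $\langle f,f\rangle_a\ \ge\ \sum_{n=1}^\infty |\langle f,g_n\rangle_a|^2$ (an inequality between functions, holding a.e.). Moreover, if $f\in \operatorname{span}(E_{m/a}g_n)_{m\in\mathbb Z,\,n\in\mathbb N}$, then $\langle f,f\rangle_a=\sum_{n=1}^\infty|\langle f,g_n\rangle_a|^2$ (a.e.).
   Context: For $a>0$ and $f,g\in L^2(\mathbb R)$ (complex-valued), the $a$-inner product is the $a$-periodic function $\langle f,g\rangle_a(t)=\sum_{n\in\mathbb Z}f(t-na)\overline{g(t-na)}$ (the series converges unconditionally for a.e. $t$ and its restriction to $[0,a]$ lies in $L^1[0,a]$), and $\|f\|_a(t)=\sqrt{\langle f,f\rangle_a(t)}$. A sequence $(g_n)$ in $L^2(\mathbb R)$ is $a$-orthonormal if $\langle g_n,g_m\rangle_a=0$ a.e. for all $n\neq m$, and for every $n$, $\|g_n\|_a(t)=1$ for a.e. $t$ with $\|g_n\|_a(t)\ne 0$. $E_c f(x)=e^{2\pi i c x}f(x)$. "span" denotes the closed linear span in $L^2(\mathbb R)$. *)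

theory Defs
  imports "HOL-Analysis.Analysis"
begin

text \<open>Elements of \<open>L\<^sup>2(\<real>)\<close> are represented by square-integrable Lebesgue measurable functions; equality
  of classes is equality almost everywhere.\<close>

definition L2 :: "(real \<Rightarrow> complex) set" where
  "L2 = {f \<in> borel_measurable lebesgue. integrable lebesgue (\<lambda>x. (cmod (f x))\<^sup>2)}"

definition L2_norm :: "(real \<Rightarrow> complex) \<Rightarrow> real" where
  "L2_norm f = sqrt (LINT x|lebesgue. (cmod (f x))\<^sup>2)"

text \<open>The membership conditions are essential: the Bochner integral in \<^const>\<open>L2_norm\<close> is \<open>0\<close> for
  functions that are not square-integrable.\<close>

definition L2_tendsto :: "(nat \<Rightarrow> real \<Rightarrow> complex) \<Rightarrow> (real \<Rightarrow> complex) \<Rightarrow> bool" where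
  "L2_tendsto s h \<longleftrightarrow> (\<forall>N. s N \<in> L2) \<and> h \<in> L2 \<and> (\<lambda>N. L2_norm (\<lambda>x. s N x - h x)) \<longlonglongrightarrow> 0"

definition L2_series_converges :: "(nat \<Rightarrow> real \<Rightarrow> complex) \<Rightarrow> bool" where
  "L2_series_converges u \<longleftrightarrow> (\<exists>h. L2_tendsto (\<lambda>N x. \<Sum>n<N. u n x) h)"

definition lin_span :: "(real \<Rightarrow> complex) set \<Rightarrow> (real \<Rightarrow> complex) set" where
  "lin_span S = {(\<lambda>x. \<Sum>u\<in>T. c u * u x) | T c. finite T \<and> T \<subseteq> S}"

definition L2_closed_span :: "(real \<Rightarrow> complex) set \<Rightarrow> (real \<Rightarrow> complex) set" where
  "L2_closed_span S = {f. \<exists>h. (\<forall>N. h N \<in> lin_span S) \<and> L2_tendsto h f}"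

text \<open>The value at a point \<open>t\<close> where the series does not converge unconditionally is \<open>0\<close>; for
  \<open>a > 0\<close> and \<open>f\<close>, \<open>g\<close> in \<open>L\<^sup>2(\<real>)\<close> these points form a null set.\<close>

definition a_inner :: "real \<Rightarrow> (real \<Rightarrow> complex) \<Rightarrow> (real \<Rightarrow> complex) \<Rightarrow> real \<Rightarrow> complex" where
  "a_inner a f g t = (\<Sum>\<^sub>\<infinity>n\<in>(UNIV :: int set). f (t - of_int n * a) * cnj (g (t - of_int n * a)))"

lemma a_inner_self:
  "a_inner a f f t = complex_of_real (\<Sum>\<^sub>\<infinity>n\<in>(UNIV :: int set). (cmod (f (t - of_int n * a)))\<^sup>2)"
proof -
  let ?r = "\<lambda>n::int. (cmod (f (t - of_int n * a)))\<^sup>2"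
  have "infsum (\<lambda>n. complex_of_real (?r n)) UNIV = complex_of_real (infsum ?r UNIV)"
  proof (cases "?r summable_on UNIV")
    case True
    then show ?thesis
      by (intro infsumI has_sum_of_real has_sum_infsum)
  next
    case False
    have "\<not> (\<lambda>n. complex_of_real (?r n)) summable_on UNIV"
      using summable_on_bounded_linear[OF bounded_linear_Re, of "\<lambda>n. complex_of_real (?r n)" UNIV] False
      by (auto simp: o_def)
    then show ?thesis
      using False by (metis (no_types, lifting) infsum_not_exists of_real_0)
  qed
  then show ?thesis
    unfolding a_inner_def complex_norm_square[symmetric] .
qed

definition a_norm :: "real \<Rightarrow> (real \<Rightarrow> complex) \<Rightarrow> real \<Rightarrow> real" where
  "a_norm a f t = sqrt (Re (a_inner a f f t))"

definition a_orthonormal :: "real \<Rightarrow> (nat \<Rightarrow> real \<Rightarrow> complex) \<Rightarrow> bool" where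
  "a_orthonormal a g \<longleftrightarrow>
     (\<forall>n. g n \<in> L2) \<and>
     (\<forall>n m. n \<noteq> m \<longrightarrow> (AE t in lebesgue. a_inner a (g n) (g m) t = 0)) \<and>
     (\<forall>n. AE t in lebesgue. a_norm a (g n) t \<noteq> 0 \<longrightarrow> a_norm a (g n) t = 1)"

definition modulation :: "real \<Rightarrow> (real \<Rightarrow> complex) \<Rightarrow> real \<Rightarrow> complex" where
  "modulation c f x = exp (2 * of_real pi * \<i> * of_real c * of_real x) * f x"

end

theory Submission
  imports Defs
begin

text \<open>
  Each \<open>f\<close> in \<open>L\<^sup>2(\<real>)\<close> is cut into its fibers \<open>k \<mapsto> f (t - k a)\<close>, which lie in \<open>\<ell>\<^sup>2(\<int>)\<close> for almost every
  \<open>t\<close>. The \<open>a\<close>-inner product at \<open>t\<close> is the \<open>\<ell>\<^sup>2\<close> inner product of the fibers, and the square of the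
  \<open>L\<^sup>2\<close> norm is the integral over one period of the squared fiber norms. For almost every \<open>t\<close> the
  fibers of the \<open>g\<^sub>n\<close> are orthogonal of norm \<open>0\<close> or \<open>1\<close>, so Bessel's inequality holds fiberwise.
  The coefficients are \<open>a\<close>-periodic, hence constant on each fiber, and integrating Bessel's inequality
  bounds the \<open>L\<^sup>2\<close> norms of the partial sums between \<open>N\<close> and \<open>M\<close> by tails of a convergent series; Fatou's
  lemma gives the limit. The fibers of an element \<open>h\<close> of the linear span of the modulated \<open>g\<^sub>n\<close> are
  linear combinations of those of the \<open>g\<^sub>n\<close>, so the defect in Bessel's inequality is fiberwise at most
  the squared distance from \<open>f\<close> to \<open>h\<close>; integrating and letting \<open>h\<close> tend to \<open>f\<close> shows that it vanishes.
\<close>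


section \<open>Square-integrable functions over an arbitrary measure\<close>

text \<open>The measure is a parameter because the calculus is used twice: with Lebesgue measure for
  \<open>L2\<close>, and with counting measure on the integers for the fibers.\<close>

definition sq_integrable :: "'i measure \<Rightarrow> ('i \<Rightarrow> complex) \<Rightarrow> bool" where
  "sq_integrable M x \<longleftrightarrow> x \<in> borel_measurable M \<and> integrable M (\<lambda>k. (cmod (x k))\<^sup>2)"

definition sq_norm :: "'i measure \<Rightarrow> ('i \<Rightarrow> complex) \<Rightarrow> real" where
  "sq_norm M x = (LINT k|M. (cmod (x k))\<^sup>2)"

definition l2_inner :: "'i measure \<Rightarrow> ('i \<Rightarrow> complex) \<Rightarrow> ('i \<Rightarrow> complex) \<Rightarrow> complex" where
  "l2_inner M x y = (LINT k|M. x k * cnj (y k))"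

lemma sq_integrable_measurable [measurable_dest]:
  "sq_integrable M x \<Longrightarrow> x \<in> borel_measurable M"
  by (simp add: sq_integrable_def)

lemma sq_norm_nonneg: "sq_norm M x \<ge> 0"
  by (simp add: sq_norm_def)

lemma nn_integral_sq_norm:
  assumes "sq_integrable M x"
  shows "(\<integral>\<^sup>+k. ennreal ((cmod (x k))\<^sup>2) \<partial>M) = ennreal (sq_norm M x)"
  unfolding sq_norm_def using assms by (intro nn_integral_eq_integral) (auto simp: sq_integrable_def)

lemma sq_integrable_count_space_iff:
  "sq_integrable (count_space UNIV) x \<longleftrightarrow> (\<integral>\<^sup>+k. ennreal ((cmod (x k))\<^sup>2) \<partial>count_space UNIV) < \<infinity>"
  by (simp add: sq_integrable_def integrable_iff_bounded)

text \<open>A finite bound on the extended integral supplies the integrability without which the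
  Bochner integral would be 0 by default.\<close>

lemma sq_norm_leI:
  assumes "u \<in> borel_measurable M" "(\<integral>\<^sup>+x. ennreal ((cmod (u x))\<^sup>2) \<partial>M) \<le> ennreal T" "T \<ge> 0"
  shows "sq_integrable M u" "sq_norm M u \<le> T"
proof -
  note [measurable] = assms(1)
  have "(\<integral>\<^sup>+x. ennreal ((cmod (u x))\<^sup>2) \<partial>M) < \<infinity>"
    using assms(2) by (simp add: order_le_less_trans)
  then show "sq_integrable M u"
    using assms(1) by (simp add: sq_integrable_def integrable_iff_bounded)
  from nn_integral_sq_norm[OF this] show "sq_norm M u \<le> T"
    using assms by simp
qed

lemma cmod_sq_le_sq_norm_count_space:
  assumes "sq_integrable (count_space UNIV) x"
  shows "(cmod (x k))\<^sup>2 \<le> sq_norm (count_space UNIV) x"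
proof -
  have "ennreal ((cmod (x k))\<^sup>2) = (\<integral>\<^sup>+i. ennreal ((cmod (x i))\<^sup>2) * indicator {k} i \<partial>count_space UNIV)"
    by simp
  also have "\<dots> \<le> (\<integral>\<^sup>+i. ennreal ((cmod (x i))\<^sup>2) \<partial>count_space UNIV)"
    by (intro nn_integral_mono) (simp add: indicator_def)
  finally show ?thesis
    unfolding nn_integral_sq_norm[OF assms] by (simp add: sq_norm_nonneg)
qed

lemma measurable_cnj [measurable]: "cnj \<in> borel_measurable borel"
  by (intro borel_measurable_continuous_onI continuous_intros)

lemma integrable_l2_inner:
  assumes "sq_integrable M x" "sq_integrable M y"
  shows "integrable M (\<lambda>k. x k * cnj (y k))"
proof (rule Bochner_Integration.integrable_bound)
  show "integrable M (\<lambda>k. (cmod (x k))\<^sup>2 + (cmod (y k))\<^sup>2)"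
    using assms by (simp add: sq_integrable_def)
  show "(\<lambda>k. x k * cnj (y k)) \<in> borel_measurable M"
    using assms[THEN sq_integrable_measurable] measurable_cnj
    by (intro borel_measurable_times measurable_compose[of y M borel cnj])
  have "cmod (x k * cnj (y k)) \<le> (cmod (x k))\<^sup>2 + (cmod (y k))\<^sup>2" for k
  proof -
    have "2 * cmod (x k) * cmod (y k) \<le> (cmod (x k))\<^sup>2 + (cmod (y k))\<^sup>2"
      by (rule sum_squares_bound)
    moreover have "0 \<le> cmod (x k) * cmod (y k)"
      by simp
    ultimately show ?thesis
      unfolding norm_mult complex_mod_cnj by linarith
  qed
  then show "AE k in M. norm (x k * cnj (y k)) \<le> norm ((cmod (x k))\<^sup>2 + (cmod (y k))\<^sup>2)"
    by simp
qed

lemma l2_inner_self: "l2_inner M x x = complex_of_real (sq_norm M x)"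
  unfolding l2_inner_def sq_norm_def complex_norm_square[symmetric]
  by (rule integral_complex_of_real)

lemma cmod_diff_squared:
  "(cmod (z - b * w))\<^sup>2 = (cmod z)\<^sup>2 - 2 * Re (cnj b * (z * cnj w)) + (cmod b)\<^sup>2 * (cmod w)\<^sup>2"
  by (simp only: cmod_power2) (simp add: power2_eq_square algebra_simps)

text \<open>All three terms of \<open>cmod_diff_squared\<close> are integrable. Combined with the
  zero function, differences also provide negatives and sums.\<close>

lemma sq_integrable_diff_scale:
  assumes "sq_integrable M x" "sq_integrable M y"
  shows "sq_integrable M (\<lambda>k. x k - b * y k)"
proof -
  have "integrable M (\<lambda>k. cnj b * (x k * cnj (y k)))"
    by (intro integrable_mult_right integrable_l2_inner assms)
  from integrable_Re[OF this] show ?thesis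
    using assms unfolding sq_integrable_def cmod_diff_squared by (auto simp del: times_complex.sel)
qed

lemma sq_integrable_diff:
  assumes "sq_integrable M x" "sq_integrable M y"
  shows "sq_integrable M (\<lambda>k. x k - y k)"
  using sq_integrable_diff_scale[OF assms, of 1] by simp

lemma l2_inner_diff_scale:
  assumes "sq_integrable M x" "sq_integrable M y" "sq_integrable M z"
  shows "l2_inner M (\<lambda>k. x k - b * y k) z = l2_inner M x z - b * l2_inner M y z"
  using integrable_l2_inner[OF assms(1,3)] integrable_l2_inner[OF assms(2,3)]
  unfolding l2_inner_def by (simp add: algebra_simps)

lemma sq_norm_diff_scale:
  assumes "sq_integrable M x" "sq_integrable M y"
  shows "sq_norm M (\<lambda>k. x k - b * y k)
    = sq_norm M x - 2 * Re (cnj b * l2_inner M x y) + (cmod b)\<^sup>2 * sq_norm M y"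
proof -
  have int: "integrable M (\<lambda>k. cnj b * (x k * cnj (y k)))"
    by (intro integrable_mult_right integrable_l2_inner assms)
  have sq: "integrable M (\<lambda>k. (cmod (x k))\<^sup>2)" "integrable M (\<lambda>k. (cmod b)\<^sup>2 * (cmod (y k))\<^sup>2)"
    using assms by (auto simp: sq_integrable_def)
  have "(LINT k|M. Re (cnj b * (x k * cnj (y k)))) = Re (cnj b * l2_inner M x y)"
    unfolding l2_inner_def integral_Re[OF int] by (simp only: integral_mult_right_zero)
  then show ?thesis
    unfolding sq_norm_def cmod_diff_squared
    using int sq by (simp del: times_complex.sel)
qed

lemma l2_inner_eq_0_if_sq_norm_0:
  assumes "sq_integrable M y" "sq_norm M y = 0"
  shows "l2_inner M x y = 0"
proof -
  have "AE k in M. (cmod (y k))\<^sup>2 = 0"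
    using assms by (subst integral_nonneg_eq_0_iff_AE[symmetric]) (auto simp: sq_integrable_def sq_norm_def)
  then show ?thesis
    unfolding l2_inner_def by (intro integral_eq_zero_AE) auto
qed

section \<open>Systems that are orthonormal up to null elements\<close>

locale orthonormal_up_to_zero =
  fixes M :: "'i measure" and G :: "nat \<Rightarrow> 'i \<Rightarrow> complex"
  assumes sq_integrable_G: "sq_integrable M (G n)"
    and orthogonal: "n \<noteq> m \<Longrightarrow> l2_inner M (G n) (G m) = 0"
    and sq_norm_G: "sq_norm M (G n) = 0 \<or> sq_norm M (G n) = 1"
begin

text \<open>Each step of the induction completes a square. The first two conjuncts feed it: the
  residual stays square-integrable, and by orthogonality subtracting earlier members leaves the
  later coefficients unchanged. With \<open>b\<close> free, the formula yields Pythagoras, Bessel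
  and approximation alike.\<close>

lemma sq_norm_residual:
  assumes "sq_integrable M F"
  shows "sq_integrable M (\<lambda>k. F k - (\<Sum>n<N. b n * G n k)) \<and>
    (\<forall>m\<ge>N. l2_inner M (\<lambda>k. F k - (\<Sum>n<N. b n * G n k)) (G m) = l2_inner M F (G m)) \<and>
    sq_norm M (\<lambda>k. F k - (\<Sum>n<N. b n * G n k))
      = sq_norm M F - (\<Sum>n<N. (cmod (l2_inner M F (G n)))\<^sup>2)
        + (\<Sum>n<N. (cmod (l2_inner M F (G n) - b n * sq_norm M (G n)))\<^sup>2)"
proof (induction N)
  case 0
  then show ?case using assms by simp
next
  case (Suc N)
  define R where "R = (\<lambda>k. F k - (\<Sum>n<N. b n * G n k))"
  have eq: "(\<lambda>k. F k - (\<Sum>n<Suc N. b n * G n k)) = (\<lambda>k. R k - b N * G N k)"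
    by (simp add: R_def algebra_simps)
  have R: "sq_integrable M R" and Rm: "\<And>m. m \<ge> N \<Longrightarrow> l2_inner M R (G m) = l2_inner M F (G m)"
    using Suc by (auto simp: R_def)
  let ?c = "l2_inner M F (G N)"
  \<comment> \<open>For a null \<open>G N\<close> the coefficient is 0 and both sides vanish; for a
    unit one this is completing the square.\<close>
  have step: "- 2 * Re (cnj (b N) * ?c) + (cmod (b N))\<^sup>2 * sq_norm M (G N)
      = - (cmod ?c)\<^sup>2 + (cmod (?c - b N * sq_norm M (G N)))\<^sup>2"
    using sq_norm_G[of N]
  proof
    assume "sq_norm M (G N) = 0"
    then show ?thesis
      using l2_inner_eq_0_if_sq_norm_0[OF sq_integrable_G] by simp
  next
    assume *: "sq_norm M (G N) = 1"
    show ?thesis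
      unfolding * by (simp only: cmod_power2) (simp add: power2_eq_square algebra_simps)
  qed
  show ?case
    unfolding eq
    using sq_integrable_diff_scale[OF R sq_integrable_G] step Suc.IH Rm
      sq_norm_diff_scale[OF R sq_integrable_G, of "b N" N]
      l2_inner_diff_scale[OF R sq_integrable_G sq_integrable_G] orthogonal
    by (auto simp: R_def)
qed

text \<open>Pythagoras as the case \<open>F = 0\<close> of \<open>sq_norm_residual\<close>: all
  coefficients vanish and the residual is the negative of the combination.\<close>

lemma sq_norm_combination:
  "sq_integrable M (\<lambda>k. \<Sum>n<N. b n * G n k)"
  "sq_norm M (\<lambda>k. \<Sum>n<N. b n * G n k) = (\<Sum>n<N. (cmod (b n))\<^sup>2 * sq_norm M (G n))"
proof -
  have "sq_integrable M (\<lambda>k. 0)"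
    by (simp add: sq_integrable_def)
  note 0 = sq_norm_residual[OF this, where N=N and b=b]
  from sq_integrable_diff[OF \<open>sq_integrable M (\<lambda>k. 0)\<close> 0[THEN conjunct1]]
  show "sq_integrable M (\<lambda>k. \<Sum>n<N. b n * G n k)" by simp
  from 0 have "sq_norm M (\<lambda>k. \<Sum>n<N. b n * G n k)
      = (\<Sum>n<N. (cmod (b n * sq_norm M (G n)))\<^sup>2)"
    by (simp add: sq_norm_def l2_inner_def)
  \<comment> \<open>The norm factor is 0 or 1, hence equal to its own square.\<close>
  also have "\<dots> = (\<Sum>n<N. (cmod (b n))\<^sup>2 * sq_norm M (G n))"
  proof (rule sum.cong[OF refl])
    show "(cmod (b n * sq_norm M (G n)))\<^sup>2 = (cmod (b n))\<^sup>2 * sq_norm M (G n)" for n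
      using sq_norm_G[of n] by auto
  qed
  finally show "sq_norm M (\<lambda>k. \<Sum>n<N. b n * G n k) = (\<Sum>n<N. (cmod (b n))\<^sup>2 * sq_norm M (G n))" .
qed

lemma sq_norm_combination_le:
  "sq_norm M (\<lambda>k. \<Sum>n<N. b n * G n k) \<le> (\<Sum>n<N. (cmod (b n))\<^sup>2)"
  unfolding sq_norm_combination(2)
proof (rule sum_mono)
  show "(cmod (b n))\<^sup>2 * sq_norm M (G n) \<le> (cmod (b n))\<^sup>2" for n
    using sq_norm_G[of n] by auto
qed

text \<open>With the coefficients themselves as \<open>b\<close>, every error term of
  \<open>sq_norm_residual\<close> is 0: the norm is 1, or it is 0 and so is the coefficient. What
  remains is the squared norm of the residual, hence nonnegative.\<close>

lemma bessel:
  assumes "sq_integrable M F"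
  shows "summable (\<lambda>n. (cmod (l2_inner M F (G n)))\<^sup>2)" (is "summable ?c")
    and "(\<Sum>n. (cmod (l2_inner M F (G n)))\<^sup>2) \<le> sq_norm M F"
proof -
  have le: "(\<Sum>n<N. ?c n) \<le> sq_norm M F" for N
  proof -
    have "(\<Sum>n<N. (cmod (l2_inner M F (G n) - l2_inner M F (G n) * sq_norm M (G n)))\<^sup>2) = 0"
    proof (intro sum.neutral ballI)
      show "(cmod (l2_inner M F (G n) - l2_inner M F (G n) * sq_norm M (G n)))\<^sup>2 = 0" for n
        using sq_norm_G[of n] l2_inner_eq_0_if_sq_norm_0[OF sq_integrable_G, of n] by auto
    qed
    then show ?thesis
      using sq_norm_residual[OF assms, where N=N and b="\<lambda>n. l2_inner M F (G n)"]
        sq_norm_nonneg[of M "\<lambda>k. F k - (\<Sum>n<N. l2_inner M F (G n) * G n k)"] by simp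
  qed
  show s: "summable ?c"
    by (rule summableI_nonneg_bounded[OF _ le]) simp
  show "suminf ?c \<le> sq_norm M F"
    by (rule suminf_le_const[OF s le])
qed

text \<open>The error terms of \<open>sq_norm_residual\<close> are dropped and the finite sum of
  squared coefficients is enlarged to the full series.\<close>

lemma best_approximation:
  assumes "sq_integrable M F"
  shows "sq_norm M F - (\<Sum>n. (cmod (l2_inner M F (G n)))\<^sup>2)
    \<le> sq_norm M (\<lambda>k. F k - (\<Sum>n<N. b n * G n k))"
proof -
  have "(\<Sum>n<N. (cmod (l2_inner M F (G n)))\<^sup>2) \<le> (\<Sum>n. (cmod (l2_inner M F (G n)))\<^sup>2)"
    by (intro sum_le_suminf bessel[OF assms]) auto
  moreover have "(\<Sum>n<N. (cmod (l2_inner M F (G n) - b n * sq_norm M (G n)))\<^sup>2) \<ge> 0"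
    by (intro sum_nonneg) simp
  ultimately show ?thesis
    using sq_norm_residual[OF assms, where N=N and b=b] by linarith
qed

end

section \<open>Fibers and periodization\<close>

lemma L2_iff: "f \<in> L2 \<longleftrightarrow> sq_integrable lebesgue f"
  by (simp add: L2_def sq_integrable_def)

lemma L2_norm_eq: "L2_norm f = sqrt (sq_norm lebesgue f)"
  by (simp add: L2_norm_def sq_norm_def)

text \<open>Both sides are \<open>0\<close> if the family is not summable.\<close>

lemma infsum_complex_eq_integral:
  fixes f :: "'i \<Rightarrow> complex"
  shows "infsum f UNIV = (LINT k|count_space UNIV. f k)"
proof (cases "f summable_on UNIV")
  case True
  then have "Infinite_Set_Sum.abs_summable_on f UNIV"
    using summable_on_iff_abs_summable_on_complex abs_summable_equivalent by blast
  then show ?thesis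
    using infsetsum_infsum[of f UNIV] by (simp add: infsetsum_def)
next
  case False
  then have "\<not> integrable (count_space UNIV) f"
    using summable_on_iff_abs_summable_on_complex abs_summable_equivalent
      Infinite_Set_Sum.abs_summable_on_def by blast
  then show ?thesis
    using False by (simp add: infsum_not_exists not_integrable_integral_eq)
qed

text \<open>Polymorphic, since periodization applies it to \<open>ennreal\<close>-valued functions
  as well as to complex ones.\<close>

abbreviation fiber :: "real \<Rightarrow> (real \<Rightarrow> 'b) \<Rightarrow> real \<Rightarrow> int \<Rightarrow> 'b" where
  "fiber a f t k \<equiv> f (t - of_int k * a)"

lemma a_inner_eq: "a_inner a f g t = l2_inner (count_space UNIV) (fiber a f t) (fiber a g t)"
  by (simp add: a_inner_def l2_inner_def infsum_complex_eq_integral)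

lemma a_inner_self_eq: "a_inner a f f t = complex_of_real (sq_norm (count_space UNIV) (fiber a f t))"
  by (simp add: a_inner_eq l2_inner_self)

text \<open>Moving \<open>t\<close> by \<open>j\<close> periods shifts the summation index by
  \<open>j\<close>, which unconditional summation does not notice. This holds at every point, so the
  coefficients are constant on every fiber without exceptional sets.\<close>

lemma a_inner_periodic: "a_inner a f g (t - of_int j * a) = a_inner a f g t"
proof -
  have "bij (\<lambda>n::int. j + n)"
    by (simp add: bij_plus_right)
  from infsum_reindex_bij_betw[OF this,
      of "\<lambda>n. f (t - of_int n * a) * cnj (g (t - of_int n * a))"]
  show ?thesis
    by (simp add: a_inner_def algebra_simps)
qed

text \<open>Lebesgue measurability can be lost under composition with a Borel map; a translation,
  however, is measurable from \<open>lebesgue\<close> to \<open>lebesgue\<close>.\<close>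

lemma measurable_fiber:
  fixes f :: "real \<Rightarrow> 'b::topological_space"
  assumes "f \<in> borel_measurable lebesgue"
  shows "(\<lambda>t. fiber a f t k) \<in> borel_measurable lebesgue"
proof -
  have "(\<lambda>x::real. - (of_int k * a) + 1 * x) \<in> lebesgue \<rightarrow>\<^sub>M lebesgue"
    using lebesgue_affine_measurable[of "\<lambda>_. 1" "- (of_int k * a) :: real"] by simp
  from measurable_compose[OF this assms] show ?thesis by simp
qed

lemma measurable_a_inner:
  assumes "f \<in> borel_measurable lebesgue" "g \<in> borel_measurable lebesgue"
  shows "a_inner a f g \<in> borel_measurable lebesgue"
proof -
  interpret sigma_finite_measure "count_space (UNIV :: int set)"
    by (rule sigma_finite_measure_count_space_countable) simp
  note [measurable] = measurable_fiber[OF assms(1)] measurable_fiber[OF assms(2)]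
  \<comment> \<open>As the integers are countable, joint measurability in \<open>t\<close> and
    \<open>k\<close> reduces to measurability in \<open>t\<close> for each \<open>k\<close>.\<close>
  have "(\<lambda>t. LINT k|count_space UNIV. fiber a f t k * cnj (fiber a g t k)) \<in> borel_measurable lebesgue"
    by (rule borel_measurable_lebesgue_integral) (unfold split_def, rule measurable_compose_countable[where g=snd], measurable)
  then show ?thesis
    by (simp add: a_inner_eq[abs_def] l2_inner_def)
qed

section \<open>Integration over one period\<close>

lemma nn_integral_fiber:
  assumes [measurable]: "u \<in> borel_measurable lebesgue"
  shows "(\<integral>\<^sup>+t. fiber a u t k \<partial>lebesgue) = (\<integral>\<^sup>+t. u t \<partial>lebesgue)"
  using nn_integral_real_affine_lebesgue[OF assms, of 1 "- (of_int k * a)"] by simp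

lemma measurable_ident_lebesgue [measurable]: "(\<lambda>x::real. x) \<in> borel_measurable lebesgue"
  by (rule measurable_completion) simp

lemma measurable_indicator_lebesgue [measurable]:
  "(indicator {s..<t::real} :: real \<Rightarrow> ennreal) \<in> borel_measurable lebesgue"
  by (rule measurable_completion) simp

text \<open>The translates of the half-open period tile the line. Tonelli takes the sum over
  \<open>k\<close> outside, translation invariance moves the shift from \<open>u\<close> onto the
  indicator, and the shifted indicators add up to 1.\<close>

lemma nn_integral_periodization:
  fixes u :: "real \<Rightarrow> ennreal"
  assumes [measurable]: "u \<in> borel_measurable lebesgue" and a: "a > 0"
  shows "(\<integral>\<^sup>+t. u t \<partial>lebesgue)
    = (\<integral>\<^sup>+t. (\<integral>\<^sup>+k. fiber a u t k \<partial>count_space UNIV) * indicator {s..<s+a} t \<partial>lebesgue)"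
proof -
  have one: "(\<integral>\<^sup>+k. indicator {s..<s+a} (t + of_int k * a) \<partial>count_space UNIV) = (1::ennreal)" for t
  proof -
    \<comment> \<open>The translate of the period by \<open>-k a\<close> contains \<open>t\<close>
      exactly when \<open>(s - t) / a \<le> k < (s - t) / a + 1\<close>, which only this ceiling
      satisfies.\<close>
    define k0 where "k0 = \<lceil>(s - t) / a\<rceil>"
    have "s \<le> t + of_int k * a \<and> t + of_int k * a < s + a \<longleftrightarrow> k = k0" for k
    proof -
      have "s \<le> t + of_int k * a \<longleftrightarrow> (s - t) / a \<le> of_int k"
        using a by (simp add: field_simps)
      moreover have "t + of_int k * a < s + a \<longleftrightarrow> of_int k - 1 < (s - t) / a"
        using a by (simp add: field_simps)
      ultimately show ?thesis
        unfolding k0_def by linarith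
    qed
    then have "indicator {s..<s+a} (t + of_int k * a) = (indicator {k0} k :: ennreal)" for k
      by (simp add: indicator_def)
    then show ?thesis
      by simp
  qed
  have [measurable]: "(\<lambda>t. indicator {s..<s+a} (t + of_int k * a) :: ennreal) \<in> borel_measurable lebesgue" for k
  proof -
    from measurable_fiber[OF measurable_indicator_lebesgue, of s "s + a" "-k" a] show ?thesis
      by simp
  qed
  note [measurable] = measurable_fiber[OF assms(1)]
  have "(\<integral>\<^sup>+t. (\<integral>\<^sup>+k. fiber a u t k \<partial>count_space UNIV) * indicator {s..<s+a} t \<partial>lebesgue)
      = (\<integral>\<^sup>+t. \<integral>\<^sup>+k. fiber a u t k * indicator {s..<s+a} t \<partial>count_space UNIV \<partial>lebesgue)"
    by (simp add: nn_integral_multc)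
  also have "\<dots> = (\<integral>\<^sup>+k. \<integral>\<^sup>+t. fiber a u t k * indicator {s..<s+a} t \<partial>lebesgue \<partial>count_space UNIV)"
    by (rule nn_integral_count_space_nn_integral) auto
  also have "\<dots> = (\<integral>\<^sup>+k. \<integral>\<^sup>+t. u t * indicator {s..<s+a} (t + of_int k * a) \<partial>lebesgue \<partial>count_space UNIV)"
  proof (rule nn_integral_cong)
    fix k
    show "(\<integral>\<^sup>+t. fiber a u t k * indicator {s..<s+a} t \<partial>lebesgue)
        = (\<integral>\<^sup>+t. u t * indicator {s..<s+a} (t + of_int k * a) \<partial>lebesgue)"
      using nn_integral_fiber[of "\<lambda>t. u t * indicator {s..<s+a} (t + of_int k * a)" k a] by simp
  qed
  also have "\<dots> = (\<integral>\<^sup>+t. \<integral>\<^sup>+k. u t * indicator {s..<s+a} (t + of_int k * a) \<partial>count_space UNIV \<partial>lebesgue)"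
    by (rule nn_integral_count_space_nn_integral[symmetric]) auto
  also have "\<dots> = (\<integral>\<^sup>+t. u t \<partial>lebesgue)"
    by (simp add: nn_integral_cmult one)
  finally show ?thesis ..
qed


text \<open>Countably many periods cover the line. Fiber quantities are periodic and in general
  integrable only over a single period, so integral arguments give almost everywhere statements one
  period at a time.\<close>

lemma AE_if_AE_on_periods:
  fixes a :: real
  assumes "a > 0" "\<And>s. AE t in lebesgue. t \<in> {s..<s+a} \<longrightarrow> P t"
  shows "AE t in lebesgue. P t"
proof -
  have "AE t in lebesgue. \<forall>j::int. t \<in> {of_int j * a..<of_int j * a + a} \<longrightarrow> P t"
    unfolding AE_all_countable using assms(2) by blast
  then show ?thesis
  proof eventually_elim
    case (elim t)
    have "t \<in> {of_int \<lfloor>t / a\<rfloor> * a..<of_int \<lfloor>t / a\<rfloor> * a + a}"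
      using \<open>a > 0\<close> floor_divide_lower[of a t] floor_divide_upper[of a t] by (simp add: algebra_simps)
    with elim show ?case by blast
  qed
qed

text \<open>By periodization the squared fiber norm, taken in \<open>ennreal\<close>, has a finite
  integral over each period and is therefore finite almost everywhere there.\<close>

lemma AE_fiber_sq_integrable:
  assumes f: "f \<in> L2" and a: "a > 0"
  shows "AE t in lebesgue. sq_integrable (count_space UNIV) (fiber a f t)"
proof (rule AE_if_AE_on_periods[OF a])
  fix s
  have f': "sq_integrable lebesgue f"
    using f by (simp add: L2_iff)
  have fm: "f \<in> borel_measurable lebesgue"
    using f' by (simp add: sq_integrable_def)
  note [measurable] = fm measurable_fiber[OF fm]
  interpret sigma_finite_measure "count_space (UNIV :: int set)"
    by (rule sigma_finite_measure_count_space_countable) simp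
  have m [measurable]: "(\<lambda>t. \<integral>\<^sup>+k. ennreal ((cmod (fiber a f t k))\<^sup>2) \<partial>count_space UNIV) \<in> borel_measurable lebesgue"
    by (rule borel_measurable_nn_integral)
      (unfold split_def, rule measurable_compose_countable[where g=snd], measurable)
  have "(\<integral>\<^sup>+t. (\<integral>\<^sup>+k. ennreal ((cmod (fiber a f t k))\<^sup>2) \<partial>count_space UNIV) * indicator {s..<s+a} t \<partial>lebesgue)
      = (\<integral>\<^sup>+t. ennreal ((cmod (f t))\<^sup>2) \<partial>lebesgue)"
    by (rule nn_integral_periodization[OF _ a, symmetric]) measurable
  also have "\<dots> \<noteq> \<infinity>"
    using nn_integral_sq_norm[OF f'] by simp
  finally have "AE t in lebesgue. (\<integral>\<^sup>+k. ennreal ((cmod (fiber a f t k))\<^sup>2) \<partial>count_space UNIV) * indicator {s..<s+a} t \<noteq> \<infinity>"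
    by (intro nn_integral_PInf_AE) measurable
  then show "AE t in lebesgue. t \<in> {s..<s+a} \<longrightarrow> sq_integrable (count_space UNIV) (fiber a f t)"
    by eventually_elim (auto simp: sq_integrable_count_space_iff less_top)
qed

text \<open>The assumption concerns the fibers because the identity is also applied to combinations
  not yet known to lie in \<open>L2\<close>.\<close>

lemma nn_integral_sq_fiber:
  assumes "f \<in> borel_measurable lebesgue" "a > 0"
    and "AE t in lebesgue. sq_integrable (count_space UNIV) (fiber a f t)"
  shows "(\<integral>\<^sup>+t. ennreal ((cmod (f t))\<^sup>2) \<partial>lebesgue)
    = (\<integral>\<^sup>+t. ennreal (sq_norm (count_space UNIV) (fiber a f t)) * indicator {s..<s+a} t \<partial>lebesgue)"
proof -
  note [measurable] = assms(1)
  have "(\<integral>\<^sup>+t. ennreal ((cmod (f t))\<^sup>2) \<partial>lebesgue)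
      = (\<integral>\<^sup>+t. (\<integral>\<^sup>+k. ennreal ((cmod (fiber a f t k))\<^sup>2) \<partial>count_space UNIV) * indicator {s..<s+a} t \<partial>lebesgue)"
    by (rule nn_integral_periodization[OF _ assms(2)]) measurable
  also have "\<dots> = (\<integral>\<^sup>+t. ennreal (sq_norm (count_space UNIV) (fiber a f t)) * indicator {s..<s+a} t \<partial>lebesgue)"
    using assms(3) by (intro nn_integral_cong_AE) (auto simp: nn_integral_sq_norm)
  finally show ?thesis .
qed

section \<open>Fibers of modulations and of their linear span\<close>

text \<open>A shift by \<open>k\<close> periods changes the exponent by
  \<open>-2 \<pi> i m k\<close>, so the modulating factor is constant along each fiber.\<close>

lemma modulation_fiber:
  assumes "a > 0"
  shows "fiber a (modulation (of_int m / a) f) t k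
    = exp (2 * of_real pi * \<i> * of_real (of_int m / a) * of_real t) * fiber a f t k"
proof -
  have "2 * of_real pi * \<i> * of_real (of_int m / a) * of_real (t - of_int k * a)
      = 2 * of_real pi * \<i> * of_real (of_int m / a) * of_real t + 2 * of_int (- (m * k)) * of_real pi * \<i>"
    using assms by (simp add: field_simps)
  moreover have "exp (2 * of_int (- (m * k)) * of_real pi * \<i>) = 1"
    using exp_integer_2pi[of "of_int (- (m * k))"] by simp
  ultimately show ?thesis
    unfolding modulation_def by (simp only: exp_add mult_1_right)
qed

lemma lin_span_fiber:
  fixes g :: "nat \<Rightarrow> real \<Rightarrow> complex"
  assumes a: "a > 0" and u: "u \<in> lin_span {modulation (of_int m / a) (g n) | (m :: int) n. True}"
  obtains N b where "\<And>k. fiber a u t k = (\<Sum>n<N. b n * fiber a (g n) t k)"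
proof -
  let ?S = "{modulation (of_int m / a) (g n) | (m :: int) n. True}"
  obtain T c where T: "finite T" "T \<subseteq> ?S" and u: "u = (\<lambda>x. \<Sum>v\<in>T. c v * v x)"
    using u by (auto simp: lin_span_def)
  have "\<forall>v\<in>T. \<exists>n e. \<forall>k. fiber a v t k = e * fiber a (g n) t k"
    using T(2) modulation_fiber[OF a] by blast
  then obtain \<nu> e where e: "\<And>v k. v \<in> T \<Longrightarrow> fiber a v t k = e v * fiber a (g (\<nu> v)) t k"
    by metis
  obtain N where N: "\<nu> ` T \<subseteq> {..<N}"
    using finite_nat_bounded[OF finite_imageI[OF T(1)], of \<nu>] by auto
  have "fiber a u t k = (\<Sum>n<N. (\<Sum>v\<in>{v \<in> T. \<nu> v = n}. c v * e v) * fiber a (g n) t k)" for k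
  proof -
    have "fiber a u t k = (\<Sum>v\<in>T. c v * e v * fiber a (g (\<nu> v)) t k)"
      by (simp add: u e mult.assoc)
    \<comment> \<open>Several elements of \<open>T\<close> may be modulations of the same
      \<open>g n\<close>, so the sum is grouped by the chosen index \<open>\<nu> v\<close>.\<close>
    also have "\<dots> = (\<Sum>n<N. \<Sum>v\<in>{v \<in> T. \<nu> v = n}. c v * e v * fiber a (g (\<nu> v)) t k)"
      by (rule sum.group[symmetric]) (use T N in auto)
    also have "\<dots> = (\<Sum>n<N. (\<Sum>v\<in>{v \<in> T. \<nu> v = n}. c v * e v) * fiber a (g n) t k)"
      by (simp add: sum_distrib_right)
    finally show ?thesis .
  qed
  then show thesis by (rule that)
qed

section \<open>Expansions in an \<open>a\<close>-orthonormal system\<close>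

locale a_orthonormal_system =
  fixes a :: real and g :: "nat \<Rightarrow> real \<Rightarrow> complex"
  assumes a_pos: "a > 0" and a_orthonormal: "a_orthonormal a g"
begin

lemma g_L2: "g n \<in> L2"
  using a_orthonormal by (simp add: a_orthonormal_def)

lemma measurable_g [measurable]: "g n \<in> borel_measurable lebesgue"
  using g_L2 by (simp add: L2_def)

text \<open>Only countably many conditions are involved, so one null set serves them all.\<close>

lemma AE_orthonormal_fibers:
  "AE t in lebesgue. orthonormal_up_to_zero (count_space UNIV) (\<lambda>n. fiber a (g n) t)"
proof -
  have "AE t in lebesgue. \<forall>n. sq_integrable (count_space UNIV) (fiber a (g n) t)"
    by (simp add: AE_all_countable AE_fiber_sq_integrable[OF g_L2 a_pos])
  moreover have "AE t in lebesgue. \<forall>n m. n \<noteq> m \<longrightarrow> a_inner a (g n) (g m) t = 0"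
    using a_orthonormal by (simp add: AE_all_countable a_orthonormal_def)
  moreover have "AE t in lebesgue. \<forall>n. a_norm a (g n) t \<noteq> 0 \<longrightarrow> a_norm a (g n) t = 1"
    using a_orthonormal by (simp add: AE_all_countable a_orthonormal_def)
  ultimately show ?thesis
    by eventually_elim
      (unfold_locales, auto simp: a_norm_def a_inner_self_eq a_inner_eq[symmetric])
qed

text \<open>Periodic coefficients are constant on each fiber, so there the sum is an ordinary linear
  combination of the fibers of the \<open>g n\<close>, and Pythagoras applies before integrating.
  The right-hand side may be infinite.\<close>

lemma nn_integral_combination_le:
  assumes "\<And>n. B n \<in> borel_measurable lebesgue" and per: "\<And>n t k. B n (t - of_int k * a) = B n t"
  shows "(\<integral>\<^sup>+x. ennreal ((cmod (\<Sum>n<N. B n x * g n x))\<^sup>2) \<partial>lebesgue)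
    \<le> (\<Sum>n<N. \<integral>\<^sup>+t. ennreal ((cmod (B n t))\<^sup>2) * indicator {s..<s+a} t \<partial>lebesgue)"
proof -
  note [measurable] = assms(1)
  let ?u = "\<lambda>x. \<Sum>n<N. B n x * g n x"
  have fib: "fiber a ?u t = (\<lambda>k. \<Sum>n<N. B n t * fiber a (g n) t k)" for t
    by (simp add: per)
  have AE: "AE t in lebesgue. sq_integrable (count_space UNIV) (fiber a ?u t)
      \<and> sq_norm (count_space UNIV) (fiber a ?u t) \<le> (\<Sum>n<N. (cmod (B n t))\<^sup>2)"
    using AE_orthonormal_fibers
  proof eventually_elim
    case (elim t)
    interpret orthonormal_up_to_zero "count_space UNIV" "\<lambda>n. fiber a (g n) t"
      by (rule elim)
    show ?case
      unfolding fib by (intro conjI sq_norm_combination sq_norm_combination_le)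
  qed
  have "(\<integral>\<^sup>+x. ennreal ((cmod (?u x))\<^sup>2) \<partial>lebesgue)
      = (\<integral>\<^sup>+t. ennreal (sq_norm (count_space UNIV) (fiber a ?u t)) * indicator {s..<s+a} t \<partial>lebesgue)"
    by (rule nn_integral_sq_fiber[OF _ a_pos]) (use AE in auto)
  also have "\<dots> \<le> (\<integral>\<^sup>+t. (\<Sum>n<N. ennreal ((cmod (B n t))\<^sup>2) * indicator {s..<s+a} t) \<partial>lebesgue)"
    using AE by (intro nn_integral_mono_AE, eventually_elim)
      (auto simp: sum_nonneg ennreal_leI simp flip: sum_distrib_right intro!: mult_right_mono)
  also have "\<dots> = (\<Sum>n<N. \<integral>\<^sup>+t. ennreal ((cmod (B n t))\<^sup>2) * indicator {s..<s+a} t \<partial>lebesgue)"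
    by (rule nn_integral_sum) measurable
  finally show ?thesis .
qed

end

section \<open>Convergence, Bessel and Parseval for a single function\<close>

locale a_orthonormal_expansion = a_orthonormal_system +
  fixes f :: "real \<Rightarrow> complex"
  assumes f_L2: "f \<in> L2"
begin

abbreviation coef :: "nat \<Rightarrow> real \<Rightarrow> complex" where
  "coef n \<equiv> a_inner a f (g n)"

lemma measurable_f [measurable]: "f \<in> borel_measurable lebesgue"
  using f_L2 by (simp add: L2_def)

lemma measurable_coef [measurable]: "coef n \<in> borel_measurable lebesgue"
  by (rule measurable_a_inner) measurable

lemma AE_bessel:
  "AE t in lebesgue. summable (\<lambda>n. (cmod (coef n t))\<^sup>2) \<and>
     (\<Sum>n. (cmod (coef n t))\<^sup>2) \<le> sq_norm (count_space UNIV) (fiber a f t)"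
  using AE_orthonormal_fibers AE_fiber_sq_integrable[OF f_L2 a_pos]
  by eventually_elim (simp add: a_inner_eq orthonormal_up_to_zero.bessel)

text \<open>Bessel's inequality is integrated over one period: the integrals of the squared
  coefficients add up to at most the squared \<open>L2\<close> norm of \<open>f\<close>. The
  endpoint \<open>0+a\<close> is the instance \<open>s = 0\<close> of \<open>s+a\<close>.\<close>

lemma coef_bound:
  obtains r where "summable r" "\<And>n. r n \<ge> 0"
    "\<And>n. (\<integral>\<^sup>+t. ennreal ((cmod (coef n t))\<^sup>2) * indicator {0..<0+a} t \<partial>lebesgue) = ennreal (r n)"
proof -
  define A where "A n = (\<integral>\<^sup>+t. ennreal ((cmod (coef n t))\<^sup>2) * indicator {0..<0+a} t \<partial>lebesgue)" for n
  have "(\<Sum>n. A n) = (\<integral>\<^sup>+t. (\<Sum>n. ennreal ((cmod (coef n t))\<^sup>2) * indicator {0..<0+a} t) \<partial>lebesgue)"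
    unfolding A_def by (rule nn_integral_suminf[symmetric]) measurable
  also have "\<dots> \<le> (\<integral>\<^sup>+t. ennreal (sq_norm (count_space UNIV) (fiber a f t)) * indicator {0..<0+a} t \<partial>lebesgue)"
    using AE_bessel by (intro nn_integral_mono_AE, eventually_elim)
      (auto simp: suminf_ennreal2 ennreal_leI intro!: mult_right_mono)
  also have "\<dots> = (\<integral>\<^sup>+t. ennreal ((cmod (f t))\<^sup>2) \<partial>lebesgue)"
    by (rule nn_integral_sq_fiber[symmetric])
      (use a_pos AE_fiber_sq_integrable[OF f_L2 a_pos] in auto)
  also have "\<dots> < \<infinity>"
    using f_L2 by (simp add: L2_iff nn_integral_sq_norm)
  finally have fin: "(\<Sum>n. A n) < \<infinity>" .
  then have "A n < \<infinity>" for n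
    using ennreal_suminf_lessD by auto
  then have A: "A n = ennreal (enn2real (A n))" for n
    by simp
  have "summable (\<lambda>n. enn2real (A n))"
    using fin by (intro summable_suminf_not_top) (auto simp flip: A)
  then show thesis
    using A by (intro that[of "\<lambda>n. enn2real (A n)"]) (auto simp: A_def)
qed

text \<open>Coordinates in \<open>\<ell>\<^sup>2(\<int>)\<close> are bounded by the norm, so convergence of the fibers is pointwise as
  well; hence no appeal to the completeness of \<open>L\<^sup>2(\<real>)\<close> is needed.\<close>

lemma AE_summable_expansion: "AE x in lebesgue. summable (\<lambda>n. coef n x * g n x)"
  using AE_orthonormal_fibers AE_bessel
proof eventually_elim
  case (elim t)
  interpret orthonormal_up_to_zero "count_space UNIV" "\<lambda>n. fiber a (g n) t"
    by (rule elim)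
  have bound: "(cmod (\<Sum>n=m..<k. coef n t * g n t))\<^sup>2 \<le> (\<Sum>n=m..<k. (cmod (coef n t))\<^sup>2)" for m k
  proof -
    \<comment> \<open>Zeroing the coefficients below \<open>m\<close> turns the block into an
      initial sum; coordinate 0 of the fiber is the value at \<open>t\<close> itself.\<close>
    let ?b = "\<lambda>n. if m \<le> n then coef n t else 0"
    have set: "{..<k} \<inter> {n. m \<le> n} = {m..<k}"
      by auto
    have "(cmod (\<Sum>n=m..<k. coef n t * g n t))\<^sup>2 = (cmod (\<Sum>n<k. ?b n * fiber a (g n) t 0))\<^sup>2"
      by (simp add: if_distrib[of "\<lambda>z. z * _"] sum.If_cases set cong: if_cong)
    also have "\<dots> \<le> sq_norm (count_space UNIV) (\<lambda>i. \<Sum>n<k. ?b n * fiber a (g n) t i)"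
      by (rule cmod_sq_le_sq_norm_count_space[OF sq_norm_combination(1)])
    also have "\<dots> \<le> (\<Sum>n<k. (cmod (?b n))\<^sup>2)"
      by (rule sq_norm_combination_le)
    also have "\<dots> = (\<Sum>n=m..<k. (cmod (coef n t))\<^sup>2)"
      by (simp add: if_distrib[of "\<lambda>z. (cmod z)\<^sup>2"] sum.If_cases set cong: if_cong)
    finally show ?thesis .
  qed
  show ?case
    unfolding summable_Cauchy
  proof (intro allI impI)
    fix \<epsilon> :: real assume "\<epsilon> > 0"
    then have "\<epsilon>\<^sup>2 > 0" by simp
    then obtain N where N: "\<And>m k. m \<ge> N \<Longrightarrow> norm (\<Sum>n=m..<k. (cmod (coef n t))\<^sup>2) < \<epsilon>\<^sup>2"
      using elim(2) unfolding summable_Cauchy by blast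
    have "norm (\<Sum>n=m..<k. coef n t * g n t) < \<epsilon>" if "m \<ge> N" for m k
    proof (rule power_less_imp_less_base[where n=2])
      show "(norm (\<Sum>n=m..<k. coef n t * g n t))\<^sup>2 < \<epsilon>\<^sup>2"
        using bound[of m k] N[OF that, of k] by (simp add: abs_of_nonneg sum_nonneg)
    qed (use \<open>\<epsilon> > 0\<close> in simp)
    then show "\<exists>N. \<forall>m\<ge>N. \<forall>k. norm (\<Sum>n=m..<k. coef n t * g n t) < \<epsilon>" by blast
  qed
qed

lemma L2_series_converges_expansion: "L2_series_converges (\<lambda>n x. coef n x * g n x)"
proof -
  obtain r where r: "summable r" "\<And>n. r n \<ge> 0"
    "\<And>n. (\<integral>\<^sup>+t. ennreal ((cmod (coef n t))\<^sup>2) * indicator {0..<0+a} t \<partial>lebesgue) = ennreal (r n)"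
    using coef_bound by blast
  define T where "T N = suminf r - (\<Sum>n<N. r n)" for N
  have T_nonneg: "T N \<ge> 0" for N
    unfolding T_def using sum_le_suminf[OF r(1), of "{..<N}"] r(2) by simp
  have T_lim: "T \<longlonglongrightarrow> 0"
    unfolding T_def using tendsto_diff[OF tendsto_const[of "suminf r"] summable_LIMSEQ[OF r(1)]] by simp
  define S where "S N x = (\<Sum>n<N. coef n x * g n x)" for N x
  \<comment> \<open>Where the series diverges the value of \<open>lim\<close> is irrelevant: this is
    a null set, and \<open>h\<close> is measurable in any case.\<close>
  define h where "h x = lim (\<lambda>N. S N x)" for x
  have S_m [measurable]: "S N \<in> borel_measurable lebesgue" for N
    unfolding S_def by measurable
  have h_m [measurable]: "h \<in> borel_measurable lebesgue"
    unfolding h_def by measurable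
  have lim: "AE x in lebesgue. (\<lambda>N. S N x) \<longlonglongrightarrow> h x"
    using AE_summable_expansion
    by eventually_elim (simp add: S_def h_def convergent_LIMSEQ_iff[symmetric] summable_iff_convergent[symmetric])
  have SS: "(\<integral>\<^sup>+x. ennreal ((cmod (S M x - S N x))\<^sup>2) \<partial>lebesgue) \<le> ennreal (T N)" if "M \<ge> N" for M N
  proof -
    let ?B = "\<lambda>n x. if N \<le> n then coef n x else 0"
    have set: "{..<M} \<inter> {n. N \<le> n} = {N..<M}"
      by auto
    have "S M x - S N x = (\<Sum>n<M. ?B n x * g n x)" for x
    proof -
      have "S M x - S N x = (\<Sum>n=N..<M. coef n x * g n x)"
        unfolding S_def lessThan_atLeast0 by (rule sum_diff_nat_ivl) (use that in auto)
      also have "\<dots> = (\<Sum>n<M. ?B n x * g n x)"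
        by (simp add: if_distrib[of "\<lambda>z. z * _"] sum.If_cases set cong: if_cong)
      finally show ?thesis .
    qed
    then have "(\<integral>\<^sup>+x. ennreal ((cmod (S M x - S N x))\<^sup>2) \<partial>lebesgue)
        = (\<integral>\<^sup>+x. ennreal ((cmod (\<Sum>n<M. ?B n x * g n x))\<^sup>2) \<partial>lebesgue)"
      by simp
    also have "\<dots> \<le> (\<Sum>n<M. \<integral>\<^sup>+t. ennreal ((cmod (?B n t))\<^sup>2) * indicator {0..<0+a} t \<partial>lebesgue)"
      by (rule nn_integral_combination_le) (auto simp: a_inner_periodic)
    also have "\<dots> = (\<Sum>n<M. ennreal (if N \<le> n then r n else 0))"
      using r(3) by (intro sum.cong refl) auto
    also have "\<dots> = ennreal (\<Sum>n=N..<M. r n)"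
      by (subst sum_ennreal) (auto simp: r(2) sum.If_cases set)
    also have "(\<Sum>n=N..<M. r n) \<le> T N"
    proof -
      have "(\<Sum>n=N..<M. r n) = (\<Sum>n<M. r n) - (\<Sum>n<N. r n)"
        unfolding lessThan_atLeast0 by (rule sum_diff_nat_ivl[symmetric]) (use that in auto)
      then show ?thesis
        using sum_le_suminf[OF r(1), of "{..<M}"] r(2) by (simp add: T_def)
    qed
    finally show ?thesis by (simp add: ennreal_leI)
  qed
  \<comment> \<open>Fatou's lemma, with \<open>N\<close> fixed and \<open>M\<close> tending to
    infinity, carries the Cauchy bound \<open>SS\<close> over to the limit.\<close>
  have hS: "(\<integral>\<^sup>+x. ennreal ((cmod (S N x - h x))\<^sup>2) \<partial>lebesgue) \<le> ennreal (T N)" for N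
  proof -
    have "(\<integral>\<^sup>+x. ennreal ((cmod (S N x - h x))\<^sup>2) \<partial>lebesgue)
        = (\<integral>\<^sup>+x. liminf (\<lambda>M. ennreal ((cmod (S M x - S N x))\<^sup>2)) \<partial>lebesgue)"
    proof (rule nn_integral_cong_AE, use lim in eventually_elim)
      case (elim x)
      have "(\<lambda>M. ennreal ((cmod (S M x - S N x))\<^sup>2)) \<longlonglongrightarrow> ennreal ((cmod (h x - S N x))\<^sup>2)"
        by (intro tendsto_intros elim)
      then show ?case
        by (metis lim_imp_Liminf norm_minus_commute trivial_limit_sequentially)
    qed
    also have "\<dots> \<le> liminf (\<lambda>M. \<integral>\<^sup>+x. ennreal ((cmod (S M x - S N x))\<^sup>2) \<partial>lebesgue)"
      by (rule nn_integral_liminf) measurable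
    also have "\<dots> \<le> ennreal (T N)"
      by (rule order_trans[OF Liminf_le_Limsup Limsup_bounded])
        (auto intro!: SS eventually_sequentiallyI[of N])
    finally show ?thesis .
  qed
  have D: "sq_integrable lebesgue (\<lambda>x. S N x - h x)" "sq_norm lebesgue (\<lambda>x. S N x - h x) \<le> T N" for N
    by (rule sq_norm_leI[OF _ hS T_nonneg]; measurable)+
  have zero: "sq_integrable lebesgue (\<lambda>x. 0)"
    by (simp add: sq_integrable_def)
  \<comment> \<open>\<open>S 0\<close> is the empty sum, so \<open>D(1)\<close> at 0 speaks of
    \<open>-h\<close>.\<close>
  have h: "sq_integrable lebesgue h"
    using sq_integrable_diff[OF zero D(1)[of 0]] by (simp add: S_def)
  have S: "sq_integrable lebesgue (S N)" for N
    using sq_integrable_diff[OF D(1)[of N] sq_integrable_diff[OF zero h]] by simp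
  have "(\<lambda>N. sq_norm lebesgue (\<lambda>x. S N x - h x)) \<longlonglongrightarrow> 0"
    by (rule tendsto_sandwich[OF _ _ tendsto_const T_lim]) (auto simp: sq_norm_nonneg D)
  from tendsto_real_sqrt[OF this] have "L2_tendsto S h"
    using S h by (simp add: L2_tendsto_def L2_iff L2_norm_eq)
  then show ?thesis
    unfolding L2_series_converges_def S_def[abs_def] by blast
qed

lemma AE_parseval:
  assumes "f \<in> L2_closed_span {modulation (of_int m / a) (g n) | (m :: int) n. True}"
  shows "AE t in lebesgue. (\<Sum>n. (cmod (coef n t))\<^sup>2) = sq_norm (count_space UNIV) (fiber a f t)"
proof (rule AE_if_AE_on_periods[OF a_pos])
  fix s
  obtain h where h: "\<And>N. h N \<in> lin_span {modulation (of_int m / a) (g n) | (m :: int) n. True}"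
    and lim: "L2_tendsto h f"
    using assms by (auto simp: L2_closed_span_def)
  define D where "D t = Re (a_inner a f f t) - (\<Sum>n. (cmod (coef n t))\<^sup>2)" for t
  have [measurable]: "a_inner a f f \<in> borel_measurable lebesgue"
    by (rule measurable_a_inner) measurable
  have [measurable]: "D \<in> borel_measurable lebesgue"
    unfolding D_def by measurable
  have le: "(\<integral>\<^sup>+t. ennreal (D t) * indicator {s..<s+a} t \<partial>lebesgue) \<le> ennreal ((L2_norm (\<lambda>x. h N x - f x))\<^sup>2)" for N
  proof -
    let ?d = "\<lambda>x. h N x - f x"
    have d: "?d \<in> L2"
      using lim f_L2 by (simp add: L2_tendsto_def L2_iff sq_integrable_diff)
    have "AE t in lebesgue. D t \<le> sq_norm (count_space UNIV) (fiber a ?d t)"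
      using AE_orthonormal_fibers AE_fiber_sq_integrable[OF f_L2 a_pos]
    proof eventually_elim
      case (elim t)
      interpret orthonormal_up_to_zero "count_space UNIV" "\<lambda>n. fiber a (g n) t"
        by (rule elim)
      \<comment> \<open>The combination may depend on \<open>t\<close> in any way: only the distance
        from \<open>f\<close> to \<open>h N\<close> enters the integral estimate.\<close>
      obtain K b where b: "\<And>k. fiber a (h N) t k = (\<Sum>n<K. b n * fiber a (g n) t k)"
        using lin_span_fiber[OF a_pos h] by blast
      have "D t \<le> sq_norm (count_space UNIV) (\<lambda>k. fiber a f t k - (\<Sum>n<K. b n * fiber a (g n) t k))"
        using best_approximation[OF elim(2)] by (simp add: D_def a_inner_self_eq) (simp add: a_inner_eq)
      then show ?case
        by (simp add: b sq_norm_def norm_minus_commute)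
    qed
    then have "(\<integral>\<^sup>+t. ennreal (D t) * indicator {s..<s+a} t \<partial>lebesgue)
        \<le> (\<integral>\<^sup>+t. ennreal (sq_norm (count_space UNIV) (fiber a ?d t)) * indicator {s..<s+a} t \<partial>lebesgue)"
      by (intro nn_integral_mono_AE, eventually_elim) (auto intro!: mult_right_mono ennreal_leI)
    also have "\<dots> = (\<integral>\<^sup>+x. ennreal ((cmod (?d x))\<^sup>2) \<partial>lebesgue)"
      by (rule nn_integral_sq_fiber[OF _ a_pos AE_fiber_sq_integrable[OF d a_pos], symmetric])
        (use d in \<open>simp add: L2_def\<close>)
    also have "\<dots> = ennreal ((L2_norm ?d)\<^sup>2)"
      using d by (simp add: L2_iff L2_norm_eq nn_integral_sq_norm sq_norm_nonneg)
    finally show ?thesis .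
  qed
  have "(\<lambda>N. ennreal ((L2_norm (\<lambda>x. h N x - f x))\<^sup>2)) \<longlonglongrightarrow> ennreal (0\<^sup>2)"
    using lim by (intro tendsto_intros) (simp add: L2_tendsto_def)
  then have "(\<integral>\<^sup>+t. ennreal (D t) * indicator {s..<s+a} t \<partial>lebesgue) \<le> ennreal (0\<^sup>2)"
    by (rule Lim_bounded2) (use le in auto)
  then have "(\<integral>\<^sup>+t. ennreal (D t) * indicator {s..<s+a} t \<partial>lebesgue) = 0"
    by simp
  then have "AE t in lebesgue. ennreal (D t) * indicator {s..<s+a} t = 0"
    by (subst (asm) nn_integral_0_iff_AE) measurable
  \<comment> \<open>\<open>ennreal\<close> sends negative reals to 0, so the vanishing integral
    gives only \<open>D t \<le> 0\<close>; Bessel's inequality gives the reverse.\<close>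
  then show "AE t in lebesgue. t \<in> {s..<s+a} \<longrightarrow>
      (\<Sum>n. (cmod (coef n t))\<^sup>2) = sq_norm (count_space UNIV) (fiber a f t)"
    using AE_bessel by eventually_elim (auto simp: D_def a_inner_self_eq ennreal_eq_0_iff)
qed

end

theorem theorem4p13:
  fixes a :: real and g :: "nat \<Rightarrow> real \<Rightarrow> complex" and f :: "real \<Rightarrow> complex"
  assumes "a > 0" and "a_orthonormal a g" and "f \<in> L2"
  shows "L2_series_converges (\<lambda>n x. a_inner a f (g n) x * g n x) \<and>
    (AE t in lebesgue. summable (\<lambda>n. (cmod (a_inner a f (g n) t))\<^sup>2) \<and>
       (\<Sum>n. (cmod (a_inner a f (g n) t))\<^sup>2) \<le> Re (a_inner a f f t)) \<and>
    (f \<in> L2_closed_span {modulation (of_int m / a) (g n) | (m :: int) n. True} \<longrightarrow>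
      (AE t in lebesgue. summable (\<lambda>n. (cmod (a_inner a f (g n) t))\<^sup>2) \<and>
         a_inner a f f t = complex_of_real (\<Sum>n. (cmod (a_inner a f (g n) t))\<^sup>2)))"
proof -
  interpret a_orthonormal_expansion a g f
    by unfold_locales fact+
  have "AE t in lebesgue. summable (\<lambda>n. (cmod (coef n t))\<^sup>2) \<and>
      a_inner a f f t = complex_of_real (\<Sum>n. (cmod (coef n t))\<^sup>2)"
    if "f \<in> L2_closed_span {modulation (of_int m / a) (g n) | (m :: int) n. True}"
    using AE_bessel AE_parseval[OF that] by eventually_elim (simp add: a_inner_self_eq)
  then show ?thesis
    using L2_series_converges_expansion AE_bessel by (simp add: a_inner_self_eq)
qed

end
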